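(* Let $A, B, C$ be types and let $R, R'$ be relations with fail from $A_\bot\times B$ to $A_\bot\times C$. If $R\sqsubseteq R'$, then $\mathrm{InstFeedback}(R)\sqsubseteq \mathrm{InstFeedback}(R')$.
   Context: Types are sets. $\bullet$ ("fail") is a fresh element not in any ordinary type, and $X^\bullet = X\cup\{\bullet\}$; elements of $X^\bullet$ other than $\bullet$ are called proper. A relation with fail from $X$ to $Y$ is a relation $R\subseteq X^\bullet\times Y^\bullet$ (written $R(x,y)$) such that $R(\bullet,\bullet)$ holds and $R(\bullet,y)$ is false for every $y\neq\bullet$. When a relation with fail is defined, only its values on proper inputs are given; on $\bullet$ it is as just described. Refinement: for relations with fail $R,R'$ from $X$ to $Y$, $R\sqsubseteq R'$ means that for all $x\in X^\bullet$: $R(x,\bullet)$ holds, or for all $y\in Y^\bullet$, $R'(x,y)$ implies $R(x,y)$. Unknown: $\bot$ is a fresh element, $A_\bot = A\cup\{\bot\}$, ordered by $a\le b \iff (a=\bot$ or $a=b)$; $a<b$ means $a\le b$ and $a\ne b$. Instantaneous feedback: for a relation with fail $R$ from $A_\bot\times B$ to $A_\bot\times C$, $\mathrm{InstFeedback}(R)$ is the relation with fail from $B$ to $A_\bot\times C$ given, for $x\in B$, $u\in A_\bot$, $y\in C$, by: $\mathrm{InstFeedback}(R)(x,(u,y))$ iff there exist $n\in\mathbb N$ and $u_0,\dots,u_n\in A_\bot$ with $u_0=\bot$, $u_n=u$, $R((u,x),(u,y))$, and for all $i<n$: $u_i<u_{i+1}$ and there is $z\in C$ with $R((u_i,x),(u_{i+1},z))$;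 $\mathrm{InstFeedback}(R)(x,\bullet)$ iff there exist $n\in\mathbb N$ and $u_0,\dots,u_n\in A_\bot$ with $u_0=\bot$, $R((u_n,x),\bullet)$, and for all $i<n$: $u_i<u_{i+1}$ and there is $z\in C$ with $R((u_i,x),(u_{i+1},z))$. *)

theory Defs
  imports Main
begin

datatype 'x failable = Fail | Proper 'x

datatype 'a unknown = Unknown | Known 'a

definition with_fail :: "'x set \<Rightarrow> 'x failable set" where
  "with_fail X = insert Fail (Proper ` X)"

definition with_unknown :: "'a set \<Rightarrow> 'a unknown set" where
  "with_unknown A = insert Unknown (Known ` A)"

definition unknown_le :: "'a unknown \<Rightarrow> 'a unknown \<Rightarrow> bool" where
  "unknown_le a b \<longleftrightarrow> a = Unknown \<or> a = b"

definition unknown_less :: "'a unknown \<Rightarrow> 'a unknown \<Rightarrow> bool" where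
  "unknown_less a b \<longleftrightarrow> unknown_le a b \<and> a \<noteq> b"

text \<open>
  The sets between which relations are formed are explicit carriers rather than HOL types,
  so that they may also be empty.
\<close>

definition fail_relation ::
    "'x set \<Rightarrow> 'y set \<Rightarrow> ('x failable \<times> 'y failable) set \<Rightarrow> bool" where
  "fail_relation X Y R \<longleftrightarrow>
     R \<subseteq> with_fail X \<times> with_fail Y \<and>
     (Fail, Fail) \<in> R \<and>
     (\<forall>y. y \<noteq> Fail \<longrightarrow> (Fail, y) \<notin> R)"

text \<open>In \<open>refines X Y R R'\<close> the relation \<open>R'\<close> is the refined (more determined) one.\<close>

definition refines ::
    "'x set \<Rightarrow> 'y set \<Rightarrow> ('x failable \<times> 'y failable) set \<Rightarrow>
       ('x failable \<times> 'y failable) set \<Rightarrow> bool" where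
  "refines X Y R R' \<longleftrightarrow>
     (\<forall>x \<in> with_fail X.
        (x, Fail) \<in> R \<or> (\<forall>y \<in> with_fail Y. (x, y) \<in> R' \<longrightarrow> (x, y) \<in> R))"

text \<open>Only the values \<open>us 0, \<dots>, us n\<close> of the sequence \<open>us\<close> are relevant.\<close>

definition feedback_chain ::
    "'a set \<Rightarrow> 'c set \<Rightarrow>
       (('a unknown \<times> 'b) failable \<times> ('a unknown \<times> 'c) failable) set \<Rightarrow>
       'b \<Rightarrow> nat \<Rightarrow> (nat \<Rightarrow> 'a unknown) \<Rightarrow> bool" where
  "feedback_chain A C R x n us \<longleftrightarrow>
     (\<forall>i \<le> n. us i \<in> with_unknown A) \<and>
     us 0 = Unknown \<and>
     (\<forall>i < n. unknown_less (us i) (us (Suc i)) \<and>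
        (\<exists>z \<in> C. (Proper (us i, x), Proper (us (Suc i), z)) \<in> R))"

definition inst_feedback ::
    "'a set \<Rightarrow> 'b set \<Rightarrow> 'c set \<Rightarrow>
       (('a unknown \<times> 'b) failable \<times> ('a unknown \<times> 'c) failable) set \<Rightarrow>
       ('b failable \<times> ('a unknown \<times> 'c) failable) set" where
  "inst_feedback A B C R =
     {(Fail, Fail)} \<union>
     {(Proper x, Proper (u, y)) | x u y.
        x \<in> B \<and> u \<in> with_unknown A \<and> y \<in> C \<and>
        (\<exists>n us. feedback_chain A C R x n us \<and> us n = u \<and>
           (Proper (u, x), Proper (u, y)) \<in> R)} \<union>
     {(Proper x, Fail) | x.
        x \<in> B \<and>
        (\<exists>n us. feedback_chain A C R x n us \<and> (Proper (us n, x), Fail) \<in> R)}"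

lemma fail_relation_inst_feedback:
  "fail_relation B (with_unknown A \<times> C) (inst_feedback A B C R)"
  by (auto simp: fail_relation_def inst_feedback_def with_fail_def)

end

(* If InstFeedback(R) cannot fail on x, then R cannot fail at the end of any of its feedback
   chains from x. So, by induction on the length, every R'-chain from x is an R-chain:
   at its last value R does not fail, hence refinement turns the next R'-step into an R-step. *)
theory Submission imports Defs begin

lemma refinesD:
  assumes "refines X Y R R'" "x \<in> X" "(Proper x, Fail) \<notin> R"
    and "(Proper x, y) \<in> R'" "y \<in> with_fail Y"
  shows "(Proper x, y) \<in> R"
  using assms unfolding refines_def with_fail_def by blast

text \<open>Since \<open>us\<close> is a total function, dropping the last link only lowers
  \<open>n\<close>; an induction on \<open>n\<close> can therefore keep \<open>us\<close>
  fixed.\<close>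

lemma feedback_chain_Suc:
  "feedback_chain A C R x (Suc n) us \<longleftrightarrow>
     feedback_chain A C R x n us \<and> us (Suc n) \<in> with_unknown A \<and>
     unknown_less (us n) (us (Suc n)) \<and>
     (\<exists>z \<in> C. (Proper (us n, x), Proper (us (Suc n), z)) \<in> R)"
  unfolding feedback_chain_def by (auto simp: less_Suc_eq le_Suc_eq)

lemma feedback_chain_in_with_unknown:
  "feedback_chain A C R x n us \<Longrightarrow> us n \<in> with_unknown A"
  unfolding feedback_chain_def by blast

text \<open>Non-failure at \<open>us n\<close> is carried along in the claim because it is what lets
  \<open>refines\<close> turn the link leaving \<open>us n\<close> into an
  \<open>R\<close>-link.\<close>

lemma feedback_chain_refines:
  assumes ref: "refines (with_unknown A \<times> B) (with_unknown A \<times> C) R R'"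
    and x: "x \<in> B" and no_fail: "(Proper x, Fail) \<notin> inst_feedback A B C R"
    and "feedback_chain A C R' x n us"
  shows "feedback_chain A C R x n us \<and> (Proper (us n, x), Fail) \<notin> R"
  using assms(4)
proof (induction n)
  case 0
  then have "feedback_chain A C R x 0 us"
    by (auto simp: feedback_chain_def)
  with x no_fail show ?case
    by (auto simp: inst_feedback_def)
next
  case (Suc n)
  then have chain: "feedback_chain A C R x n us" "(Proper (us n, x), Fail) \<notin> R"
    by (auto simp: feedback_chain_Suc)
  from Suc.prems obtain z where z: "z \<in> C" "us (Suc n) \<in> with_unknown A"
      "(Proper (us n, x), Proper (us (Suc n), z)) \<in> R'"
    by (auto simp: feedback_chain_Suc)
  have "(Proper (us n, x), Proper (us (Suc n), z)) \<in> R"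
    using refinesD[OF ref _ chain(2) z(3)] z x feedback_chain_in_with_unknown[OF chain(1)]
    by (simp add: with_fail_def)
  with chain z Suc.prems have "feedback_chain A C R x (Suc n) us"
    by (auto simp: feedback_chain_Suc)
  \<comment> \<open>A failure of \<open>R\<close> at the end of the chain just built would put
    \<open>Fail\<close> among the outputs for \<open>x\<close>, against
    \<open>no_fail\<close>.\<close>
  with x no_fail show ?case
    by (auto simp: inst_feedback_def)
qed

theorem theorem6:
  fixes A :: "'a set" and B :: "'b set" and C :: "'c set"
    and R R' :: "(('a unknown \<times> 'b) failable \<times> ('a unknown \<times> 'c) failable) set"
  assumes "fail_relation (with_unknown A \<times> B) (with_unknown A \<times> C) R"
    and "fail_relation (with_unknown A \<times> B) (with_unknown A \<times> C) R'"
    and "refines (with_unknown A \<times> B) (with_unknown A \<times> C) R R'"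
  shows "refines B (with_unknown A \<times> C) (inst_feedback A B C R) (inst_feedback A B C R')"
proof -
  have "(Proper x, y) \<in> inst_feedback A B C R"
    if x: "x \<in> B" and no_fail: "(Proper x, Fail) \<notin> inst_feedback A B C R"
      and y: "(Proper x, y) \<in> inst_feedback A B C R'" for x y
  proof -
    \<comment> \<open>Letting \<open>w\<close> be any output, proper or \<open>Fail\<close>, covers
      both ways in which a feedback computation can end.\<close>
    have step: "feedback_chain A C R x n us \<and> (Proper (us n, x), w) \<in> R"
      if "feedback_chain A C R' x n us" "(Proper (us n, x), w) \<in> R'"
        "w \<in> with_fail (with_unknown A \<times> C)" for n us w
      using feedback_chain_refines[OF assms(3) x no_fail that(1)] refinesD[OF assms(3) _ _ that(2,3)]
        feedback_chain_in_with_unknown[OF that(1)] x by simp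
    show ?thesis
    proof (cases y)
      case Fail
      with y obtain n us where "feedback_chain A C R' x n us" "(Proper (us n, x), Fail) \<in> R'"
        by (auto simp: inst_feedback_def)
      from step[OF this] x Fail show ?thesis
        by (auto simp: inst_feedback_def with_fail_def)
    next
      case (Proper w)
      \<comment> \<open>The fixed-point condition maps \<open>us n\<close> to itself, so it is not a
        strictly increasing link of the chain and needs its own transfer by
        \<open>step\<close>.\<close>
      with y obtain n us c where w: "w = (us n, c)" "c \<in> C" "us n \<in> with_unknown A"
          "feedback_chain A C R' x n us" "(Proper (us n, x), Proper (us n, c)) \<in> R'"
        by (auto simp: inst_feedback_def)
      from step[OF w(4,5)] w x Proper show ?thesis
        by (auto simp: inst_feedback_def with_fail_def)
    qed
  qed
  \<comment> \<open>On the input \<open>Fail\<close> the first alternative of \<open>refines\<close>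
    holds, which leaves only proper inputs.\<close>
  moreover have "(Fail, Fail) \<in> inst_feedback A B C R"
    by (simp add: inst_feedback_def)
  ultimately show ?thesis
    unfolding refines_def with_fail_def by blast
qed

end
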